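(* Let $n,N\ge3$ be integers and let $(\Delta_n^i)_{2\le i\le N}$ be any instruction set generator. Then the map $\phi_n:B_n\to A_n$ is well defined and is a bijection between $B_n$ and $A_n$.
   Context: $S_n$ is the symmetric group on $\{1,\dots,n\}$, with composition written $\sigma_1\sigma_2=\sigma_2\circ\sigma_1$. An instruction set is a subset $\Delta_n=\{f_2,\dots,f_n\}\subset S_n$ of $n-1$ permutations with $f_k(k)=1$ for each $k$. An instruction set generator is a family of functions $\Delta_n^i:S_n^{i-1}\to\mathcal{P}(S_n)$, $2\le i\le N$, each of whose values is an instruction set. Let $V(K_n)=\{v_1,\dots,v_n\}$. $A_n$ is the set of column vectors $(v_{i_1},\dots,v_{i_N})$ with entries in $V(K_n)$, $v_{i_1}=v_1$, $v_{i_2}=v_2$, and $v_{i_j}\ne v_{i_{j+1}}$ for all $j$. $B_n$ is the set of column vectors $(\sigma_1,\dots,\sigma_N)$ of permutations with $\sigma_1=\mathrm{id}$, $\sigma_2=f_2$ (the element of $\Delta_n^2(\mathrm{id})$ with $f_2(2)=1$), and $\sigma_i\in\Delta_n^i(\sigma_1,\dots,\sigma_{i-1})$ for $i\ge2$. Let $D_n$ be the set of $n$-tuples of pairwise distinct elements of $V(K_n)$, with $S_n$ acting by $\sigma\cdot(v_{s_1},\dots,v_{s_n})=(v_{s_{\sigma^{-1}(1)}},\dots,v_{s_{\sigma^{-1}(n)}})$. For $(\sigma_1,\dots,\sigma_N)\in B_n$ set $o_1=(v_1,\dots,v_n)$ and $o_j=\sigma_j\cdot o_{j-1}$ for $2\le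 j\le N$; then $\phi_n(\sigma_1,\dots,\sigma_N)$ is the column whose $j$-th entry is the first coordinate of $o_j$. *)

theory Defs
  imports "HOL-Combinatorics.Permutations" "HOL-Library.FuncSet"
begin

text \<open>An \<open>m\<close>-tuple over \<open>S\<close> is an element of \<open>{1..m} \<rightarrow>\<^sub>E S\<close>, so that indices start at 1
  and distinct functions are distinct tuples.\<close>

definition sym_perms :: "nat \<Rightarrow> (nat \<Rightarrow> nat) set" where
  "sym_perms n = {p. p permutes {1..n}}"

definition instruction_set :: "nat \<Rightarrow> (nat \<Rightarrow> nat) set \<Rightarrow> bool" where
  "instruction_set n D \<longleftrightarrow>
     (\<exists>f. (\<forall>k\<in>{2..n}. f k \<in> sym_perms n \<and> f k k = 1) \<and> D = f ` {2..n} \<and> card D = n - 1)"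

text \<open>The element \<open>f\<^sub>k\<close> of an instruction set. It is unique: \<open>f\<^sub>j k = 1 = f\<^sub>j j\<close> forces \<open>j = k\<close>.\<close>

definition instruction :: "(nat \<Rightarrow> nat) set \<Rightarrow> nat \<Rightarrow> (nat \<Rightarrow> nat)" where
  "instruction D k = (THE f. f \<in> D \<and> f k = 1)"

definition instruction_set_generator ::
    "nat \<Rightarrow> nat \<Rightarrow> (nat \<Rightarrow> (nat \<Rightarrow> nat \<Rightarrow> nat) \<Rightarrow> (nat \<Rightarrow> nat) set) \<Rightarrow> bool" where
  "instruction_set_generator n N \<Delta> \<longleftrightarrow>
     (\<forall>i\<in>{2..N}. \<forall>\<sigma>\<in>{1..i - 1} \<rightarrow>\<^sub>E sym_perms n. instruction_set n (\<Delta> i \<sigma>))"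

text \<open>The vertices \<open>v 1, \<dots>, v n\<close> of the complete graph are given by an enumeration \<open>v\<close>
  that is injective on \<open>{1..n}\<close>.\<close>

definition walk_columns :: "nat \<Rightarrow> nat \<Rightarrow> (nat \<Rightarrow> 'a) \<Rightarrow> (nat \<Rightarrow> 'a) set" where
  "walk_columns n N v =
     {x \<in> {1..N} \<rightarrow>\<^sub>E v ` {1..n}.
        x 1 = v 1 \<and> x 2 = v 2 \<and> (\<forall>j\<in>{1..N - 1}. x j \<noteq> x (j + 1))}"

definition permutation_columns ::
    "nat \<Rightarrow> nat \<Rightarrow> (nat \<Rightarrow> (nat \<Rightarrow> nat \<Rightarrow> nat) \<Rightarrow> (nat \<Rightarrow> nat) set) \<Rightarrow> (nat \<Rightarrow> nat \<Rightarrow> nat) set" where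
  "permutation_columns n N \<Delta> =
     {\<sigma> \<in> {1..N} \<rightarrow>\<^sub>E sym_perms n.
        \<sigma> 1 = id \<and> \<sigma> 2 = instruction (\<Delta> 2 (\<lambda>j\<in>{1..1}. id)) 2 \<and>
        (\<forall>i\<in>{2..N}. \<sigma> i \<in> \<Delta> i (restrict \<sigma> {1..i - 1}))}"

definition distinct_tuples :: "nat \<Rightarrow> (nat \<Rightarrow> 'a) \<Rightarrow> (nat \<Rightarrow> 'a) set" where
  "distinct_tuples n v = {s \<in> {1..n} \<rightarrow>\<^sub>E v ` {1..n}. inj_on s {1..n}}"

definition perm_act :: "nat \<Rightarrow> (nat \<Rightarrow> nat) \<Rightarrow> (nat \<Rightarrow> 'a) \<Rightarrow> (nat \<Rightarrow> 'a)" where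
  "perm_act n p s = (\<lambda>i\<in>{1..n}. s (inv p i))"

text \<open>The tuples \<open>o\<^sub>1, o\<^sub>2, \<dots>\<close>; index 0 is not used.\<close>

fun vertex_order :: "nat \<Rightarrow> (nat \<Rightarrow> 'a) \<Rightarrow> (nat \<Rightarrow> nat \<Rightarrow> nat) \<Rightarrow> nat \<Rightarrow> (nat \<Rightarrow> 'a)" where
  "vertex_order n v \<sigma> 0 = undefined"
| "vertex_order n v \<sigma> (Suc 0) = restrict v {1..n}"
| "vertex_order n v \<sigma> (Suc (Suc j)) = perm_act n (\<sigma> (Suc (Suc j))) (vertex_order n v \<sigma> (Suc j))"

definition phi :: "nat \<Rightarrow> nat \<Rightarrow> (nat \<Rightarrow> 'a) \<Rightarrow> (nat \<Rightarrow> nat \<Rightarrow> nat) \<Rightarrow> (nat \<Rightarrow> 'a)" where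
  "phi n N v \<sigma> = (\<lambda>j\<in>{1..N}. vertex_order n v \<sigma> j 1)"

end

theory Submission imports Defs begin

text \<open>An instruction \<open>f\<^sub>k\<close> brings the \<open>k\<close>-th entry of the current tuple, with \<open>k \<ge> 2\<close>, to the
  front. The tuple lists every vertex exactly once, so each vertex other than the current first
  entry comes to the front by exactly one instruction of the current set. Hence the
  permutations of a column and the vertices of a walk determine each other one step at a time.\<close>

section \<open>Instruction sets\<close>

lemma instruction_setE:
  assumes "instruction_set n D" "f \<in> D"
  obtains k where "f permutes {1..n}" "k \<in> {2..n}" "f k = 1"
  using assms by (auto simp: instruction_set_def sym_perms_def)

text \<open>If \<open>g j\<close> sends \<open>k\<close> to 1, it sends both \<open>k\<close> and
  \<open>j\<close> to 1, so injectivity forces \<open>k = j\<close>. This justifies the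
  \<open>THE\<close> in \<open>instruction\<close> and makes the choice of a position
  \<open>k\<close> equivalent to the choice of an instruction.\<close>

lemma instruction_set_ex1:
  assumes "instruction_set n D" "k \<in> {2..n}"
  shows "\<exists>!f. f \<in> D \<and> f k = 1"
proof -
  obtain g where g: "\<And>j. j \<in> {2..n} \<Longrightarrow> g j permutes {1..n} \<and> g j j = 1" and D: "D = g ` {2..n}"
    using assms(1) unfolding instruction_set_def sym_perms_def by blast
  have "f = g k" if f: "f \<in> D" "f k = 1" for f
  proof -
    obtain j where j: "j \<in> {2..n}" "f = g j" using f(1) D by blast
    have "g j k = g j j" using f(2) g[OF j(1)] j(2) by simp
    then have "k = j" using injD[OF permutes_inj[OF conjunct1[OF g[OF j(1)]]]] by simp
    then show ?thesis using j(2) by simp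
  qed
  moreover have "g k \<in> D \<and> g k k = 1"
    using g[OF assms(2)] D assms(2) by simp
  ultimately show ?thesis by blast
qed

lemma instruction_props:
  assumes "instruction_set n D" "k \<in> {2..n}"
  shows "instruction D k \<in> D" "instruction D k k = 1"
  using theI'[OF instruction_set_ex1[OF assms]] by (simp_all add: instruction_def)

section \<open>The action on tuples and the vertex orders\<close>

text \<open>The action reads the tuple through \<open>inv f\<close>, and \<open>f k = 1\<close>
  means \<open>inv f 1 = k\<close>.\<close>

lemma perm_act_first:
  assumes "f permutes {1..n}" "f k = 1" "1 \<le> n"
  shows "perm_act n f s 1 = s k"
  using assms by (simp add: perm_act_def permutes_inv_eq[THEN iffD2])

lemma perm_act_distinct_tuples:
  assumes "f permutes {1..n}" "s \<in> distinct_tuples n v"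
  shows "perm_act n f s \<in> distinct_tuples n v"
proof -
  have inv: "inv f permutes {1..n}" by (rule permutes_inv[OF assms(1)])
  have "inj_on (s \<circ> inv f) {1..n}"
    using assms(2) inv
    by (intro comp_inj_on) (auto simp: distinct_tuples_def permutes_image permutes_inj_on)
  then have "inj_on (perm_act n f s) {1..n}"
    by (rule inj_on_cong[THEN iffD1, rotated]) (simp add: perm_act_def)
  moreover have "perm_act n f s \<in> {1..n} \<rightarrow>\<^sub>E v ` {1..n}"
    unfolding perm_act_def
  proof (rule restrict_PiE_iff[THEN iffD2], rule ballI)
    fix i assume "i \<in> {1..n}"
    then have "inv f i \<in> {1..n}" using permutes_in_image[OF inv] by blast
    then show "s (inv f i) \<in> v ` {1..n}" using assms(2) unfolding distinct_tuples_def by blast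
  qed
  ultimately show ?thesis by (simp add: distinct_tuples_def)
qed

text \<open>By counting: \<open>s\<close> takes \<open>n\<close> different values inside a set of at
  most \<open>n\<close> elements. Surjectivity uses this to find the next vertex of a walk somewhere
  in the current tuple.\<close>

lemma distinct_tuples_image:
  assumes "s \<in> distinct_tuples n v"
  shows "s ` {1..n} = v ` {1..n}"
proof (rule card_subset_eq)
  have inj: "inj_on s {1..n}" using assms by (simp add: distinct_tuples_def)
  show sub: "s ` {1..n} \<subseteq> v ` {1..n}" using assms by (auto simp: distinct_tuples_def)
  show "card (s ` {1..n}) = card (v ` {1..n})"
    using card_image[OF inj] card_mono[OF _ sub] card_image_le[of "{1..n}" v] by simp
qed simp

lemma vertex_order_Suc:
  assumes "1 \<le> j"
  shows "vertex_order n v \<sigma> (Suc j) = perm_act n (\<sigma> (Suc j)) (vertex_order n v \<sigma> j)"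
  using assms by (cases j) auto

lemma vertex_order_cong:
  assumes "\<And>i. i \<in> {1..j} \<Longrightarrow> \<sigma> i = \<tau> i"
  shows "vertex_order n v \<sigma> j = vertex_order n v \<tau> j"
  using assms
proof (induction j)
  case (Suc j)
  have "vertex_order n v \<sigma> j = vertex_order n v \<tau> j"
    using Suc.prems by (intro Suc.IH) simp
  then show ?case
    \<comment> \<open>For \<open>j = 0\<close> the tuple is the initial one, which no permutation
      enters; otherwise the recursion adds only the entry at \<open>Suc j\<close>.\<close>
    using Suc.prems[of "Suc j"] by (cases j) simp_all
qed simp

lemma vertex_order_distinct_tuples:
  assumes "inj_on v {1..n}" "\<And>i. i \<in> {1..j} \<Longrightarrow> \<sigma> i permutes {1..n}" "1 \<le> j"
  shows "vertex_order n v \<sigma> j \<in> distinct_tuples n v"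
  using assms(3,2)
proof (induction j rule: dec_induct)
  case base
  have "inj_on (restrict v {1..n}) {1..n}"
    using assms(1) by simp
  moreover have "restrict v {1..n} \<in> {1..n} \<rightarrow>\<^sub>E v ` {1..n}"
    by (intro restrict_PiE_iff[THEN iffD2] ballI imageI)
  ultimately show ?case
    unfolding distinct_tuples_def One_nat_def vertex_order.simps by blast
next
  case (step j)
  have "vertex_order n v \<sigma> j \<in> distinct_tuples n v"
    using step.prems by (intro step.IH) simp
  then show ?case
    using step.prems step.hyps by (simp add: vertex_order_Suc perm_act_distinct_tuples)
qed

section \<open>Columns of permutations and their single steps\<close>

lemma permutation_columns_permutes:
  assumes "\<sigma> \<in> permutation_columns n N \<Delta>" "i \<in> {1..N}"
  shows "\<sigma> i permutes {1..n}"
  using assms by (auto simp: permutation_columns_def sym_perms_def)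

lemma permutation_columns_mem:
  assumes "\<sigma> \<in> permutation_columns n N \<Delta>" "i \<in> {2..N}"
  shows "\<sigma> i \<in> \<Delta> i (restrict \<sigma> {1..i - 1})"
  using assms by (simp add: permutation_columns_def)

lemma permutation_columns_distinct_tuples:
  assumes "inj_on v {1..n}" "\<sigma> \<in> permutation_columns n N \<Delta>" "j \<in> {1..N}"
  shows "vertex_order n v \<sigma> j \<in> distinct_tuples n v"
  using assms(3) permutation_columns_permutes[OF assms(2)]
  by (intro vertex_order_distinct_tuples[OF assms(1)]) simp_all

text \<open>The column length \<open>M\<close> is separate from \<open>N\<close>, and
  \<open>i = Suc M\<close> is allowed, so that the set offering the next entry of a partial column
  is covered as well.\<close>

lemma permutation_columns_instruction_set:
  assumes "instruction_set_generator n N \<Delta>" "\<sigma> \<in> permutation_columns n M \<Delta>"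
    and "2 \<le> i" "i \<le> N" "i \<le> Suc M"
  shows "instruction_set n (\<Delta> i (restrict \<sigma> {1..i - 1}))"
proof -
  have "restrict \<sigma> {1..i - 1} \<in> {1..i - 1} \<rightarrow>\<^sub>E sym_perms n"
    using assms by (auto simp: permutation_columns_def)
  then show ?thesis using assms by (auto simp: instruction_set_generator_def)
qed

text \<open>The index \<open>k\<close> is the one for which \<open>\<sigma> (Suc j)\<close> is the
  instruction. That \<open>k\<close> is at least 2 shows that the front vertex changes; that it
  labels the instruction is what injectivity needs.\<close>

lemma permutation_columns_step:
  assumes "instruction_set_generator n N \<Delta>" "\<sigma> \<in> permutation_columns n N \<Delta>"
    and "1 \<le> j" "j < N"
  obtains k where "k \<in> {2..n}" "\<sigma> (Suc j) k = 1"
    and "vertex_order n v \<sigma> (Suc j) 1 = vertex_order n v \<sigma> j k"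
proof -
  have "\<sigma> (Suc j) \<in> \<Delta> (Suc j) (restrict \<sigma> {1..Suc j - 1})"
    using permutation_columns_mem[OF assms(2), of "Suc j"] assms(3,4) by simp
  moreover have "instruction_set n (\<Delta> (Suc j) (restrict \<sigma> {1..Suc j - 1}))"
    using assms by (intro permutation_columns_instruction_set[OF assms(1,2)]) auto
  ultimately obtain k
    where k: "\<sigma> (Suc j) permutes {1..n}" "k \<in> {2..n}" "\<sigma> (Suc j) k = 1"
    by (blast elim: instruction_setE)
  moreover have "vertex_order n v \<sigma> (Suc j) 1 = vertex_order n v \<sigma> j k"
    using perm_act_first[OF k(1,3)] k(2) by (simp only: vertex_order_Suc[OF assms(3)]) simp
  ultimately show thesis using that by blast
qed

section \<open>Images of columns are walks\<close>

lemma phi_in_walk_columns: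
  assumes "n \<ge> 2" "N \<ge> 2" "inj_on v {1..n}" "instruction_set_generator n N \<Delta>"
    and \<sigma>: "\<sigma> \<in> permutation_columns n N \<Delta>"
  shows "phi n N v \<sigma> \<in> walk_columns n N v"
proof -
  note tuple = permutation_columns_distinct_tuples[OF assms(3) \<sigma>]
  have "phi n N v \<sigma> \<in> {1..N} \<rightarrow>\<^sub>E v ` {1..n}"
    unfolding phi_def
  proof (rule restrict_PiE_iff[THEN iffD2], rule ballI)
    fix j assume "j \<in> {1..N}"
    from tuple[OF this] show "vertex_order n v \<sigma> j 1 \<in> v ` {1..n}"
      using assms(1) by (auto simp: distinct_tuples_def)
  qed
  moreover have "phi n N v \<sigma> 1 = v 1"
    using assms(1,2) by (simp add: phi_def)
  moreover have "phi n N v \<sigma> 2 = v 2"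
  proof -
    \<comment> \<open>This is the history named in the condition on \<open>\<sigma> 2\<close>; on an
      instruction set the \<open>THE\<close> there does yield a permutation sending 2 to 1.\<close>
    have "instruction_set n (\<Delta> 2 (\<lambda>j\<in>{1..1}. id))"
      using assms(2,4) unfolding instruction_set_generator_def
      by (auto simp: sym_perms_def)
    then have "\<sigma> 2 2 = 1"
      using instruction_props(2) \<sigma> assms(1) by (auto simp: permutation_columns_def)
    moreover have "\<sigma> 2 permutes {1..n}"
      using permutation_columns_permutes[OF \<sigma>] assms(2) by simp
    ultimately have "perm_act n (\<sigma> 2) (restrict v {1..n}) 1 = restrict v {1..n} 2"
      using assms(1) by (intro perm_act_first) auto
    then have "vertex_order n v \<sigma> 2 1 = restrict v {1..n} 2"
      by (simp add: numeral_2_eq_2)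
    then show ?thesis using assms(1,2) by (simp add: phi_def)
  qed
  moreover have "phi n N v \<sigma> j \<noteq> phi n N v \<sigma> (j + 1)" if j: "j \<in> {1..N - 1}" for j
  proof -
    have "1 \<le> j" "j < N" using j by auto
    then obtain k where k: "k \<in> {2..n}" "vertex_order n v \<sigma> (Suc j) 1 = vertex_order n v \<sigma> j k"
      by (rule permutation_columns_step[OF assms(4) \<sigma>])
    \<comment> \<open>Consecutive walk vertices are the entries at the distinct positions 1 and
      \<open>k\<close> of this one tuple.\<close>
    have "inj_on (vertex_order n v \<sigma> j) {1..n}"
      using tuple[of j] j by (auto simp: distinct_tuples_def)
    from inj_onD[OF this, of 1 k] k(1)
    have "vertex_order n v \<sigma> j 1 \<noteq> vertex_order n v \<sigma> j k" by auto
    then show ?thesis using k(2) j by (auto simp: phi_def)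
  qed
  ultimately show ?thesis by (simp add: walk_columns_def)
qed

section \<open>Injectivity of \<open>phi\<close>\<close>

lemma inj_on_phi:
  assumes "inj_on v {1..n}" "instruction_set_generator n N \<Delta>"
  shows "inj_on (phi n N v) (permutation_columns n N \<Delta>)"
proof (rule inj_onI)
  fix \<sigma> \<tau>
  assume \<sigma>: "\<sigma> \<in> permutation_columns n N \<Delta>" and \<tau>: "\<tau> \<in> permutation_columns n N \<Delta>"
    and eq: "phi n N v \<sigma> = phi n N v \<tau>"
  have first: "vertex_order n v \<sigma> i 1 = vertex_order n v \<tau> i 1" if "i \<in> {1..N}" for i
    using fun_cong[OF eq, of i] that by (simp add: phi_def)
  have "\<sigma> i = \<tau> i" if "i \<in> {1..N}" for i
    using that
  proof (induction i rule: less_induct)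
    case (less i)
    show ?case
    proof (cases "i = 1")
      case True
      then show ?thesis using \<sigma> \<tau> by (simp add: permutation_columns_def)
    next
      case False
      then obtain j where j: "i = Suc j" "1 \<le> j" "j < N"
        using less.prems by (cases i) auto
      have agree: "\<sigma> l = \<tau> l" if "l \<in> {1..j}" for l
        using less that j by auto
      obtain k where k: "k \<in> {2..n}" "\<sigma> i k = 1"
        "vertex_order n v \<sigma> i 1 = vertex_order n v \<sigma> j k"
        using permutation_columns_step[OF assms(2) \<sigma> j(2,3)] j(1) by metis
      obtain l where l: "l \<in> {2..n}" "\<tau> i l = 1"
        "vertex_order n v \<tau> i 1 = vertex_order n v \<tau> j l"
        using permutation_columns_step[OF assms(2) \<tau> j(2,3)] j(1) by metis
      \<comment> \<open>Agreement of the columns up to \<open>j\<close> gives a common tuple at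
        \<open>j\<close>, so equal front vertices at \<open>i\<close> are equal entries of that
        tuple.\<close>
      have "vertex_order n v \<sigma> j k = vertex_order n v \<sigma> j l"
        using first[OF less.prems] k(3) l(3) vertex_order_cong[of j \<sigma> \<tau> n v, OF agree] by simp
      moreover have "inj_on (vertex_order n v \<sigma> j) {1..n}"
        using permutation_columns_distinct_tuples[OF assms(1) \<sigma>, of j] j
        by (simp add: distinct_tuples_def)
      ultimately have "k = l" using k(1) l(1) by (auto dest: inj_onD)
      let ?D = "\<Delta> i (restrict \<sigma> {1..i - 1})"
      \<comment> \<open>Equal histories make both columns choose from the same set
        \<open>?D\<close>, where position \<open>k\<close> determines the instruction.\<close>
      have "restrict \<sigma> {1..i - 1} = restrict \<tau> {1..i - 1}"
        using agree j(1) by (auto simp: restrict_def)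
      then have "\<sigma> i \<in> ?D" "\<tau> i \<in> ?D"
        using permutation_columns_mem[OF \<sigma>, of i] permutation_columns_mem[OF \<tau>, of i] j by simp_all
      moreover have "instruction_set n ?D"
        using permutation_columns_instruction_set[OF assms(2) \<sigma>, of i] j by simp
      ultimately show ?thesis
        using instruction_set_ex1 k(1,2) l(2) \<open>k = l\<close> by blast
    qed
  qed
  then show "\<sigma> = \<tau>"
    using \<sigma> \<tau> by (intro PiE_ext[of _ "{1..N}" "\<lambda>_. sym_perms n"]) (auto simp: permutation_columns_def)
qed

section \<open>Surjectivity: building a column along a walk\<close>

text \<open>Being extensional on \<open>{1..M}\<close>, \<open>\<sigma>\<close> is itself the
  history for the entry at \<open>Suc M\<close>. With \<open>2 \<le> M\<close> the update leaves the
  two prescribed entries alone.\<close>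

lemma permutation_columns_extend:
  assumes \<sigma>: "\<sigma> \<in> permutation_columns n M \<Delta>" and M: "2 \<le> M"
    and f: "f \<in> \<Delta> (Suc M) \<sigma>" "f permutes {1..n}"
  shows "\<sigma>(Suc M := f) \<in> permutation_columns n (Suc M) \<Delta>"
proof -
  let ?\<tau> = "\<sigma>(Suc M := f)"
  have ext: "\<sigma> \<in> {1..M} \<rightarrow>\<^sub>E sym_perms n"
    using \<sigma> by (simp add: permutation_columns_def)
  have "?\<tau> \<in> {1..Suc M} \<rightarrow>\<^sub>E sym_perms n"
    using PiE_fun_upd[OF _ ext, of f "Suc M"] f(2)
    by (simp add: sym_perms_def atLeastAtMostSuc_conv)
  moreover have "?\<tau> i \<in> \<Delta> i (restrict ?\<tau> {1..i - 1})" if i: "i \<in> {2..Suc M}" for i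
  proof (cases "i = Suc M")
    case True
    have "restrict ?\<tau> {1..M} = restrict \<sigma> {1..M}" by (auto simp: restrict_def)
    also have "\<dots> = \<sigma>" using ext by (rule PiE_restrict)
    finally show ?thesis using True f(1) by simp
  next
    case False
    have "restrict ?\<tau> {1..i - 1} = restrict \<sigma> {1..i - 1}"
      using i by (intro restrict_ext) auto
    then show ?thesis using False i \<sigma> by (simp add: permutation_columns_def)
  qed
  ultimately show ?thesis using \<sigma> M by (simp add: permutation_columns_def)
qed

text \<open>Induction on the length \<open>M\<close> of a prefix of the walk, starting at 2 because
  the first two entries are prescribed on both sides.\<close>

lemma walk_has_permutation_column:
  assumes "n \<ge> 2" "inj_on v {1..n}" "instruction_set_generator n N \<Delta>"
    and x: "x \<in> walk_columns n N v" and M: "2 \<le> M" "M \<le> N"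
  shows "\<exists>\<sigma>\<in>permutation_columns n M \<Delta>. \<forall>j\<in>{1..M}. vertex_order n v \<sigma> j 1 = x j"
  using M
proof (induction M rule: dec_induct)
  case base
  \<comment> \<open>The one-entry history; \<open>c(2 := f)\<close> will be the column of length
    2.\<close>
  define c where "c = (\<lambda>j\<in>{1..1::nat}. id :: nat \<Rightarrow> nat)"
  define f where "f = instruction (\<Delta> 2 c) 2"
  have c: "c \<in> {1..1} \<rightarrow>\<^sub>E sym_perms n" "c 1 = id"
    by (auto simp: c_def sym_perms_def)
  have D: "instruction_set n (\<Delta> 2 c)"
    using assms(3)[unfolded instruction_set_generator_def, rule_format, of 2 c] c(1) base by simp
  have "2 \<in> {2..n}" using assms(1) by simp
  note f = instruction_props[OF D this, folded f_def]
  have perm: "f permutes {1..n}" using D f(1) by (blast elim: instruction_setE)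
  have set2: "{1..2::nat} = insert 2 {1..1}" "{2..2::nat} = {2}" by auto
  have "restrict (c(2 := f)) {1..1} = restrict c {1..1}" by (intro restrict_ext) auto
  also have "\<dots> = c" using c(1) by (rule PiE_restrict)
  finally have res: "restrict (c(2 := f)) {1..2 - 1} = c" by simp
  have "c(2 := f) \<in> {1..2} \<rightarrow>\<^sub>E sym_perms n"
    unfolding set2(1) using perm c(1) by (intro PiE_fun_upd) (simp_all add: sym_perms_def)
  moreover have "(c(2 := f)) 1 = id" "(c(2 := f)) 2 = instruction (\<Delta> 2 (\<lambda>j\<in>{1..1}. id)) 2"
    using c(2) by (simp_all add: f_def c_def)
  moreover have "\<forall>i\<in>{2..2}. (c(2 := f)) i \<in> \<Delta> i (restrict (c(2 := f)) {1..i - 1})"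
    unfolding set2(2) using f(1) res by simp
  ultimately have "c(2 := f) \<in> permutation_columns n 2 \<Delta>"
    unfolding permutation_columns_def by blast
  moreover have "vertex_order n v (c(2 := f)) 1 1 = x 1"
    using x assms(1) by (simp add: walk_columns_def)
  moreover have "vertex_order n v (c(2 := f)) 2 1 = x 2"
  proof -
    have "vertex_order n v (c(2 := f)) 2 = perm_act n f (restrict v {1..n})"
      by (simp add: numeral_2_eq_2)
    then have "vertex_order n v (c(2 := f)) 2 1 = restrict v {1..n} 2"
      using assms(1) by (simp only: perm_act_first[OF perm f(2)])
    then show ?thesis
      using x assms(1) by (simp add: walk_columns_def)
  qed
  ultimately show ?case
    unfolding set2(1) by (intro bexI[of _ "c(2 := f)"]) (simp_all del: fun_upd_apply)
next
  case (step M)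
  then obtain \<sigma> where \<sigma>: "\<sigma> \<in> permutation_columns n M \<Delta>"
    and walk: "\<And>j. j \<in> {1..M} \<Longrightarrow> vertex_order n v \<sigma> j 1 = x j" by auto
  have "restrict \<sigma> {1..M} = \<sigma>"
    using \<sigma> by (auto simp: permutation_columns_def intro: PiE_restrict)
  then have D: "instruction_set n (\<Delta> (Suc M) \<sigma>)"
    using permutation_columns_instruction_set[OF assms(3) \<sigma>, of "Suc M"] step by simp
  have s: "vertex_order n v \<sigma> M \<in> distinct_tuples n v"
    using permutation_columns_distinct_tuples[OF assms(2) \<sigma>] step by simp
  have "x (Suc M) \<in> v ` {1..n}"
    using x step by (auto simp: walk_columns_def)
  then obtain k where k: "k \<in> {1..n}" "x (Suc M) = vertex_order n v \<sigma> M k"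
    using distinct_tuples_image[OF s] by (metis imageE)
  have "x M \<noteq> x (Suc M)"
    using x step by (auto simp: walk_columns_def)
  \<comment> \<open>Position 1 of the tuple at \<open>M\<close> holds \<open>x M\<close>, which
    differs from the next vertex; so an instruction for \<open>k\<close> exists.\<close>
  then have "k \<noteq> 1" using walk[of M] k(2) step by auto
  then have k2: "k \<in> {2..n}" using k(1) by auto
  obtain f where f: "f \<in> \<Delta> (Suc M) \<sigma>" "f k = 1"
    using instruction_set_ex1[OF D k2] by blast
  have perm: "f permutes {1..n}" using D f(1) by (blast elim: instruction_setE)
  let ?\<tau> = "\<sigma>(Suc M := f)"
  have same: "vertex_order n v ?\<tau> j = vertex_order n v \<sigma> j" if "j \<le> M" for j
    using that by (intro vertex_order_cong) auto
  have "vertex_order n v ?\<tau> (Suc M) = perm_act n f (vertex_order n v \<sigma> M)"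
    using step by (simp add: vertex_order_Suc same)
  then have "vertex_order n v ?\<tau> (Suc M) 1 = x (Suc M)"
    using perm_act_first[OF perm f(2)] assms(1) k(2) by simp
  then have "\<forall>j\<in>{1..Suc M}. vertex_order n v ?\<tau> j 1 = x j"
    using walk same by (auto simp: le_Suc_eq)
  moreover have "?\<tau> \<in> permutation_columns n (Suc M) \<Delta>"
    by (rule permutation_columns_extend[OF \<sigma> step.hyps(1)]) (fact f(1) perm)+
  ultimately show ?case by blast
qed

theorem theorem24:
  fixes n N :: nat
    and v :: "nat \<Rightarrow> 'a"
    and \<Delta> :: "nat \<Rightarrow> (nat \<Rightarrow> nat \<Rightarrow> nat) \<Rightarrow> (nat \<Rightarrow> nat) set"
  assumes "n \<ge> 3" and "N \<ge> 3"
    and "inj_on v {1..n}"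
    and "instruction_set_generator n N \<Delta>"
  shows "(\<forall>\<sigma>\<in>permutation_columns n N \<Delta>. \<forall>j\<in>{1..N}. vertex_order n v \<sigma> j \<in> distinct_tuples n v)
    \<and> phi n N v \<in> permutation_columns n N \<Delta> \<rightarrow> walk_columns n N v
    \<and> bij_betw (phi n N v) (permutation_columns n N \<Delta>) (walk_columns n N v)"
proof -
  have n: "n \<ge> 2" and N: "N \<ge> 2" using assms(1,2) by auto
  have maps: "phi n N v \<in> permutation_columns n N \<Delta> \<rightarrow> walk_columns n N v"
    using phi_in_walk_columns[OF n N assms(3,4)] by blast
  have "x \<in> phi n N v ` permutation_columns n N \<Delta>" if x: "x \<in> walk_columns n N v" for x
  proof -
    obtain \<sigma> where \<sigma>: "\<sigma> \<in> permutation_columns n N \<Delta>"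
      and walk: "\<forall>j\<in>{1..N}. vertex_order n v \<sigma> j 1 = x j"
      using walk_has_permutation_column[OF n assms(3,4) x N] by auto
    \<comment> \<open>Both \<open>x\<close> and \<open>phi n N v \<sigma>\<close> are
      \<open>undefined\<close> outside \<open>{1..N}\<close>, so agreement on the indices gives
      equality of functions.\<close>
    have "x \<in> extensional {1..N}" using x by (simp add: walk_columns_def PiE_iff)
    then have "x = phi n N v \<sigma>"
      using walk by (intro extensionalityI[of _ "{1..N}"]) (auto simp: phi_def)
    then show ?thesis using \<sigma> by blast
  qed
  then have "bij_betw (phi n N v) (permutation_columns n N \<Delta>) (walk_columns n N v)"
    using maps inj_on_phi[OF assms(3,4)] by (auto simp: bij_betw_def)
  then show ?thesis
    using maps permutation_columns_distinct_tuples[OF assms(3)] by blast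
qed

end
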